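(* Let $\mathcal{E} = (X, P_{\theta} ; \theta \in \Theta)$ be an experiment such that for some $C \geq 1$ and $s > 0$ there exists a probability measure $Q$ on $X$ such that for each $\theta \in \Theta$, $Q$ is $(C,s)$-indistinguishable from $P_{\theta}$. Then for every $n \in \{1,2,\dotsc\}$ $$\delta(\mathcal{E}^{\otimes n}, \mathcal{E}^{\otimes n+1}) \leq C\sqrt{\frac{\pi}{4s}}\,\frac{1}{\sqrt{n+1}}.$$
   Context: An experiment $\mathcal{E} = (X, P_{\theta} ; \theta \in \Theta)$ consists of a parameter set $\Theta$, a measurable space $X$ (the sample space) and a family $(P_\theta)_{\theta\in\Theta}$ of probability measures on $X$. For $n \in \{1,2,\dotsc\}$ its $n$-fold repetition is $\mathcal{E}^{\otimes n} = (X^{\otimes n}, P_\theta^{\otimes n} ; \theta\in\Theta)$, with $X^{\otimes n}$ the $n$-fold product measurable space and $P_\theta^{\otimes n}$ the $n$-fold product measure. A finite normalised decision problem on $\Theta$ is a pair $(A,L)$ with $A$ a finite set (with the discrete $\sigma$-algebra) and $L \colon A\times\Theta\to[0,1]$. A decision procedure for $(A,L)$ on observing $\mathcal{E}$ is a Markov kernel $\rho$ from $X$ to $A$, and its risk at $\theta$ is $R_{\mathcal{E}}(\rho,\theta)=\int\int L(a,\theta)\,\rho_x(da)\,P_\theta(dx)$. For two experiments $\mathcal{E}$ and $\mathcal{F}$ on the same parameter set $\Theta$ (with possibly different sample spaces $X$ and $Y$), the deficiency $\delta(\mathcal{E},\mathcal{F})$ is the smallest number (infimum) $\varepsilon\geq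 0$ such that for every finite normalised decision problem $(A,L)$ on $\Theta$ and every decision procedure $\rho$ on $Y$ there exists a decision procedure $\rho'$ on $X$ with $R_{\mathcal{E}}(\rho',\theta)\leq R_{\mathcal{F}}(\rho,\theta)+\varepsilon$ for all $\theta\in\Theta$. $(C,s)$-indistinguishability: for $C\geq 1$, $s>0$, a probability measure $Q$ on $X$ is $(C,s)$-indistinguishable from a probability measure $P$ on $X$ if there exists a density $g$ (non-negative measurable function) on $X$ with $dQ = g\,dP$ such that for independent $\xi_1,\xi_2,\dotsc\sim P$, all $n\in\{1,2,\dotsc\}$ and all $t\geq 0$, $$\mathbb{P}\Big(\Big|\sum_{i=1}^n g(\xi_i)-n\Big|>nt\Big)\leq C e^{-snt^2}.$$ *)

theory Defs
  imports "HOL-Probability.Probability"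
begin

definition statistical_experiment :: "'t set \<Rightarrow> 'x measure \<Rightarrow> ('t \<Rightarrow> 'x measure) \<Rightarrow> bool" where
  "statistical_experiment \<Theta> X P \<longleftrightarrow> (\<forall>\<theta>\<in>\<Theta>. prob_space (P \<theta>) \<and> sets (P \<theta>) = sets X)"

abbreviation power_measure :: "'x measure \<Rightarrow> nat \<Rightarrow> (nat \<Rightarrow> 'x) measure" where
  "power_measure M n \<equiv> PiM {..<n} (\<lambda>_. M)"

text \<open>Finite action sets are taken as subsets of \<^typ>\<open>nat\<close>: a quantifier inside a definition
  cannot range over types, and every finite set is in bijection with a finite set of naturals.\<close>

definition decision_problem :: "'t set \<Rightarrow> nat set \<Rightarrow> (nat \<Rightarrow> 't \<Rightarrow> real) \<Rightarrow> bool" where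
  "decision_problem \<Theta> A L \<longleftrightarrow> finite A \<and> (\<forall>a\<in>A. \<forall>\<theta>\<in>\<Theta>. L a \<theta> \<in> {0..1})"

definition decision_procedures :: "'x measure \<Rightarrow> nat set \<Rightarrow> ('x \<Rightarrow> nat measure) set" where
  "decision_procedures X A = measurable X (prob_algebra (count_space A))"

definition risk :: "('t \<Rightarrow> 'x measure) \<Rightarrow> (nat \<Rightarrow> 't \<Rightarrow> real) \<Rightarrow> ('x \<Rightarrow> nat measure) \<Rightarrow> 't \<Rightarrow> real" where
  "risk P L \<rho> \<theta> = (\<integral>x. (\<integral>a. L a \<theta> \<partial>(\<rho> x)) \<partial>(P \<theta>))"

definition deficient_by ::
  "'t set \<Rightarrow> 'x measure \<Rightarrow> ('t \<Rightarrow> 'x measure) \<Rightarrow> 'y measure \<Rightarrow> ('t \<Rightarrow> 'y measure) \<Rightarrow> real \<Rightarrow> bool" where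
  "deficient_by \<Theta> X P Y P' \<epsilon> \<longleftrightarrow>
     (\<forall>A L. decision_problem \<Theta> A L \<longrightarrow>
       (\<forall>\<rho>\<in>decision_procedures Y A. \<exists>\<rho>'\<in>decision_procedures X A.
          \<forall>\<theta>\<in>\<Theta>. risk P L \<rho>' \<theta> \<le> risk P' L \<rho> \<theta> + \<epsilon>))"

definition deficiency ::
  "'t set \<Rightarrow> 'x measure \<Rightarrow> ('t \<Rightarrow> 'x measure) \<Rightarrow> 'y measure \<Rightarrow> ('t \<Rightarrow> 'y measure) \<Rightarrow> real" where
  "deficiency \<Theta> X P Y P' = Inf {\<epsilon>. 0 \<le> \<epsilon> \<and> deficient_by \<Theta> X P Y P' \<epsilon>}"

lemma risk_bounds:
  assumes dp: "decision_problem \<Theta> A L" and \<theta>: "\<theta> \<in> \<Theta>"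
    and M: "prob_space (P \<theta>)" "sets (P \<theta>) = sets Z" and \<kappa>: "\<kappa> \<in> decision_procedures Z A"
  shows "risk P L \<kappa> \<theta> \<in> {0..1}"
proof -
  have inner: "(\<integral>a. L a \<theta> \<partial>(\<kappa> x)) \<in> {0..1}" if x: "x \<in> space (P \<theta>)" for x
  proof -
    have "x \<in> space Z" using x M(2) sets_eq_imp_space_eq by blast
    then have "\<kappa> x \<in> space (prob_algebra (count_space A))"
      using \<kappa> unfolding decision_procedures_def by (rule measurable_space[rotated])
    then have k: "prob_space (\<kappa> x)" "sets (\<kappa> x) = sets (count_space A)"
      by (auto simp: space_prob_algebra)
    have sp: "space (\<kappa> x) = A" using sets_eq_imp_space_eq[OF k(2)] by simp
    interpret K: prob_space "\<kappa> x" by (rule k(1))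
    have b: "0 \<le> L a \<theta>" "L a \<theta> \<le> 1" if "a \<in> space (\<kappa> x)" for a
      using dp that \<theta> sp by (auto simp: decision_problem_def)
    have "(\<integral>a. L a \<theta> \<partial>(\<kappa> x)) \<le> 1"
      by (rule K.integral_le_const[OF K.integrable_const_bound[where B=1]])
         (use b in \<open>auto intro!: AE_I2 simp: measurable_cong_sets[OF k(2) refl]\<close>)
    moreover have "0 \<le> (\<integral>a. L a \<theta> \<partial>(\<kappa> x))"
      by (rule integral_nonneg_AE) (use b in auto)
    ultimately show ?thesis by simp
  qed
  interpret M: prob_space "P \<theta>" by (rule M(1))
  have "0 \<le> (\<integral>x. (\<integral>a. L a \<theta> \<partial>(\<kappa> x)) \<partial>P \<theta>)"
    by (rule integral_nonneg_AE) (use inner in auto)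
  moreover have "(\<integral>x. (\<integral>a. L a \<theta> \<partial>(\<kappa> x)) \<partial>P \<theta>) \<le> 1"
  proof (cases "integrable (P \<theta>) (\<lambda>x. (\<integral>a. L a \<theta> \<partial>(\<kappa> x)))")
    case True
    then show ?thesis by (rule M.integral_le_const) (use inner in auto)
  qed (simp add: not_integrable_integral_eq)
  ultimately show ?thesis by (simp add: risk_def)
qed

text \<open>For a nonempty space \<open>Y\<close> the infimum in \<open>deficiency\<close> is, by the following lemma, over a nonempty set
  bounded below, so it is not the unspecified value of \<^const>\<open>Inf\<close> on \<^typ>\<open>real\<close>.\<close>

lemma deficient_by_1:
  assumes P: "statistical_experiment \<Theta> X P" and P': "statistical_experiment \<Theta> Y P'"
    and Y: "space Y \<noteq> {}"
  shows "deficient_by \<Theta> X P Y P' 1"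
  unfolding deficient_by_def
proof (intro allI impI ballI)
  fix A :: "nat set" and L :: "nat \<Rightarrow> 'a \<Rightarrow> real" and \<rho>
  assume dp: "decision_problem \<Theta> A L" and \<rho>: "\<rho> \<in> decision_procedures Y A"
  obtain y where y: "y \<in> space Y" using Y by blast
  have "(\<lambda>_. \<rho> y) \<in> decision_procedures X A"
    using measurable_space[OF \<rho>[unfolded decision_procedures_def] y]
    by (simp add: decision_procedures_def)
  moreover have "risk P L (\<lambda>_. \<rho> y) \<theta> \<le> risk P' L \<rho> \<theta> + 1" if "\<theta> \<in> \<Theta>" for \<theta>
    using risk_bounds[of \<Theta> A L \<theta> P X "\<lambda>_. \<rho> y"] risk_bounds[of \<Theta> A L \<theta> P' Y \<rho>]
      dp that P P' \<rho> calculation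
    by (auto simp: statistical_experiment_def)
  ultimately show "\<exists>\<rho>'\<in>decision_procedures X A. \<forall>\<theta>\<in>\<Theta>. risk P L \<rho>' \<theta> \<le> risk P' L \<rho> \<theta> + 1"
    by blast
qed

text \<open>The i.i.d. sequence is realised by the coordinate maps on the infinite product of \<open>P\<close>;
  lemma \<open>indistinguishable_iid\<close> below shows that the bound then holds on every
  probability space carrying such a sequence.\<close>

definition indistinguishable :: "real \<Rightarrow> real \<Rightarrow> 'x measure \<Rightarrow> 'x measure \<Rightarrow> bool" where
  "indistinguishable C s Q P \<longleftrightarrow>
     (\<exists>g :: 'x \<Rightarrow> real. g \<in> borel_measurable P \<and> (\<forall>x\<in>space P. 0 \<le> g x) \<and>
        Q = density P (\<lambda>x. ennreal (g x)) \<and>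
        (\<forall>n::nat. n \<ge> 1 \<longrightarrow> (\<forall>t\<ge>0.
           measure (PiM UNIV (\<lambda>_::nat. P))
             {\<xi> \<in> space (PiM UNIV (\<lambda>_::nat. P)). \<bar>(\<Sum>i<n. g (\<xi> i)) - real n\<bar> > real n * t}
           \<le> C * exp (- (s * real n * t\<^sup>2)))))"

lemma indistinguishable_iid:
  assumes "indistinguishable C s Q P" "prob_space P"
  obtains g :: "'x \<Rightarrow> real" where "g \<in> borel_measurable P" "\<And>x. x \<in> space P \<Longrightarrow> 0 \<le> g x"
    "Q = density P (\<lambda>x. ennreal (g x))"
    "\<And>(M :: 'w measure) \<xi> n t. prob_space M \<Longrightarrow> prob_space.indep_vars M (\<lambda>_. P) \<xi> UNIV \<Longrightarrow>
       (\<And>i. distr M P (\<xi> i) = P) \<Longrightarrow> n \<ge> 1 \<Longrightarrow> t \<ge> 0 \<Longrightarrow>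
       measure M {\<omega> \<in> space M. \<bar>(\<Sum>i<n. g (\<xi> i \<omega>)) - real n\<bar> > real n * t}
         \<le> C * exp (- (s * real n * t\<^sup>2))"
proof -
  from assms(1) obtain g :: "'x \<Rightarrow> real" where g: "g \<in> borel_measurable P"
    "\<And>x. x \<in> space P \<Longrightarrow> 0 \<le> g x" "Q = density P (\<lambda>x. ennreal (g x))"
    and bd: "\<And>n t. n \<ge> 1 \<Longrightarrow> t \<ge> 0 \<Longrightarrow> measure (PiM UNIV (\<lambda>_::nat. P))
       {\<xi> \<in> space (PiM UNIV (\<lambda>_::nat. P)). \<bar>(\<Sum>i<n. g (\<xi> i)) - real n\<bar> > real n * t}
           \<le> C * exp (- (s * real n * t\<^sup>2))"
    unfolding indistinguishable_def by blast
  have "measure M {\<omega> \<in> space M. \<bar>(\<Sum>i<n. g (\<xi> i \<omega>)) - real n\<bar> > real n * t}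
         \<le> C * exp (- (s * real n * t\<^sup>2))"
    if M: "prob_space M" and ind: "prob_space.indep_vars M (\<lambda>_. P) \<xi> UNIV"
      and d: "\<And>i. distr M P (\<xi> i) = P" and n: "n \<ge> 1" and t: "t \<ge> 0"
    for M :: "'w measure" and \<xi> n t
  proof -
    interpret prob_space M by (rule M)
    let ?S = "PiM UNIV (\<lambda>_::nat. P)" and ?f = "\<lambda>\<omega>. \<lambda>i\<in>UNIV. \<xi> i \<omega>"
    let ?E = "{\<xi> \<in> space ?S. \<bar>(\<Sum>i<n. g (\<xi> i)) - real n\<bar> > real n * t}"
    have m: "\<And>i. \<xi> i \<in> measurable M P" using ind by (auto simp: indep_vars_def)
    have eq: "distr M ?S ?f = ?S"
      using ind indep_vars_iff_distr_eq_PiM[of UNIV \<xi> "\<lambda>_. P"] m d by simp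
    have fm: "?f \<in> measurable M ?S" using m by (intro measurable_restrict)
    note g(1)[measurable]
    have E: "?E \<in> sets ?S" by measurable
    have "measure ?S ?E = measure (distr M ?S ?f) ?E" using eq by simp
    also have "\<dots> = measure M (?f -` ?E \<inter> space M)" by (rule measure_distr[OF fm E])
    also have "?f -` ?E \<inter> space M = {\<omega> \<in> space M. \<bar>(\<Sum>i<n. g (\<xi> i \<omega>)) - real n\<bar> > real n * t}"
      using measurable_space[OF fm] by auto
    finally show ?thesis using bd[OF n t] by simp
  qed
  with g show ?thesis by (rule that)
qed

end

theory Submission
  imports Defs
begin

text \<open>From an observation of \<open>n\<close> coordinates, draw an extra point from \<open>Q\<close> and insert it at a
  uniformly random position. If \<open>Q\<close> has density \<open>g\<close> with respect to \<open>P\<close>, the resulting law has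
  density \<open>z \<mapsto> (\<Sum>k\<le>n. g (z k)) / (n + 1)\<close> with respect to the \<open>(n + 1)\<close>-fold power of \<open>P\<close>.
  The risk therefore grows by at most the \<open>L\<^sup>1\<close> distance of this average from \<open>1\<close>, which is
  bounded by integrating the sub-Gaussian tail.\<close>

section \<open>Integration of sub-Gaussian tails\<close>

text \<open>The value \<open>h x\<close> is the Lebesgue measure of \<open>{0..<h x}\<close>;
  exchanging the integrals over \<open>x\<close> and \<open>t\<close> by Tonelli gives the tail
  formula.\<close>

lemma nn_integral_layer_cake:
  assumes "sigma_finite_measure M" and h[measurable]: "h \<in> borel_measurable M"
    and nonneg: "\<And>x. x \<in> space M \<Longrightarrow> (0::real) \<le> h x"
  shows "(\<integral>\<^sup>+x. ennreal (h x) \<partial>M) =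
    (\<integral>\<^sup>+t. indicator {0..} t * emeasure M {x \<in> space M. t < h x} \<partial>lborel)"
proof -
  interpret M: sigma_finite_measure M by fact
  interpret pair_sigma_finite M lborel ..
  let ?f = "\<lambda>x t. indicator {0..} t * indicator {x \<in> space M. t < h x} x :: ennreal"
  have "(\<integral>\<^sup>+x. ennreal (h x) \<partial>M) = (\<integral>\<^sup>+x. (\<integral>\<^sup>+t. ?f x t \<partial>lborel) \<partial>M)"
  proof (rule nn_integral_cong)
    fix x assume x: "x \<in> space M"
    have "(\<integral>\<^sup>+t. ?f x t \<partial>lborel) = (\<integral>\<^sup>+t. indicator {0..<h x} t \<partial>lborel)"
      using x by (intro nn_integral_cong) (auto simp: indicator_def)
    then show "ennreal (h x) = (\<integral>\<^sup>+t. ?f x t \<partial>lborel)"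
      using nonneg[OF x] by simp
  qed
  also have "\<dots> = (\<integral>\<^sup>+t. (\<integral>\<^sup>+x. ?f x t \<partial>M) \<partial>lborel)"
    by (rule Fubini'[symmetric]) measurable
  also have "\<dots> = (\<integral>\<^sup>+t. indicator {0..} t * emeasure M {x \<in> space M. t < h x} \<partial>lborel)"
    by (intro nn_integral_cong) (simp add: nn_integral_cmult)
  finally show ?thesis .
qed

text \<open>The substitution \<open>x = sqrt c * t\<close> reduces the integral to the standard
  half-Gaussian value \<open>sqrt pi / 2\<close>.\<close>

lemma nn_integral_half_gaussian:
  assumes c: "(c::real) > 0"
  shows "(\<integral>\<^sup>+t. ennreal (indicator {0..} t * exp (- (c * t\<^sup>2))) \<partial>lborel) = ennreal (sqrt (pi / (4 * c)))"
proof -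
  let ?f = "\<lambda>x::real. ennreal (indicator {0..} x * exp (- x\<^sup>2))"
  have std: "(\<integral>\<^sup>+x. ?f x \<partial>lborel) = ennreal (sqrt pi / 2)"
    using gaussian_moment_0 by (subst nn_integral_eq_integral) (auto simp: has_bochner_integral_iff)
  have sc: "ennreal (sqrt pi / 2) = ennreal (sqrt c) * (\<integral>\<^sup>+t. ?f (0 + sqrt c * t) \<partial>lborel)"
    using nn_integral_real_affine[of ?f "sqrt c" 0] c std by simp
  \<comment> \<open>Inserting the factor \<open>1 / sqrt c * sqrt c = 1\<close> solves
    \<open>sc\<close> for the integral without cancelling in \<open>ennreal\<close>.\<close>
  have "(\<integral>\<^sup>+t. ?f (0 + sqrt c * t) \<partial>lborel) =
      ennreal (1 / sqrt c) * (ennreal (sqrt c) * (\<integral>\<^sup>+t. ?f (0 + sqrt c * t) \<partial>lborel))"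
    using c by (simp add: mult.assoc[symmetric] ennreal_mult[symmetric])
  also have "\<dots> = ennreal (sqrt (pi / (4 * c)))"
    unfolding sc[symmetric] using c by (simp add: ennreal_mult[symmetric] real_sqrt_divide real_sqrt_mult)
  also have "(\<integral>\<^sup>+t. ?f (0 + sqrt c * t) \<partial>lborel) =
      (\<integral>\<^sup>+t. ennreal (indicator {0..} t * exp (- (c * t\<^sup>2))) \<partial>lborel)"
    using c by (intro nn_integral_cong)
      (auto simp: indicator_def power_mult_distrib zero_le_mult_iff)
  finally show ?thesis .
qed

text \<open>The layer-cake formula turns the tail bound into the integral of
  \<open>C * exp (- (c * t\<^sup>2))\<close> over the half-line, which is where the constant comes
  from.\<close>

lemma nn_integral_subgaussian_tail:
  assumes "prob_space M" and h: "h \<in> borel_measurable M"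
    and nonneg: "\<And>x. x \<in> space M \<Longrightarrow> (0::real) \<le> h x" and c: "c > 0" and C: "C \<ge> 0"
    and tail: "\<And>t. t \<ge> 0 \<Longrightarrow> measure M {x \<in> space M. t < h x} \<le> C * exp (- (c * t\<^sup>2))"
  shows "(\<integral>\<^sup>+x. ennreal (h x) \<partial>M) \<le> ennreal (C * sqrt (pi / (4 * c)))"
proof -
  interpret prob_space M by fact
  have "(\<integral>\<^sup>+x. ennreal (h x) \<partial>M) =
      (\<integral>\<^sup>+t. indicator {0..} t * emeasure M {x \<in> space M. t < h x} \<partial>lborel)"
    by (rule nn_integral_layer_cake) (use h nonneg in \<open>auto intro: sigma_finite_measure_axioms\<close>)
  also have "\<dots> \<le> (\<integral>\<^sup>+t. ennreal C * ennreal (indicator {0..} t * exp (- (c * t\<^sup>2))) \<partial>lborel)"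
    using tail C by (intro nn_integral_mono)
      (auto simp: indicator_def emeasure_eq_measure ennreal_mult[symmetric] intro!: ennreal_leI)
  also have "\<dots> = ennreal C * ennreal (sqrt (pi / (4 * c)))"
    using nn_integral_half_gaussian[OF c] by (subst nn_integral_cmult) auto
  finally show ?thesis using C c by (simp add: ennreal_mult)
qed

section \<open>Insertion of a point and its effect on power measures\<close>

text \<open>The entry displaced from position \<open>k\<close> moves to the end, so that inserting is appending followed by
  a transposition, under which a power measure is invariant.\<close>

definition insert_at :: "nat \<Rightarrow> nat \<Rightarrow> 'x \<Rightarrow> (nat \<Rightarrow> 'x) \<Rightarrow> nat \<Rightarrow> 'x" where
  "insert_at n k y x = (\<lambda>i\<in>{..<Suc n}. (x(n := y)) (Transposition.transpose k n i))"

lemma insert_at_nth: "k \<le> n \<Longrightarrow> insert_at n k y x k = y"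
  by (simp add: insert_at_def)

lemma measurable_insert_at:
  assumes "k \<le> n"
  shows "(\<lambda>(y, x). insert_at n k y x) \<in> X \<Otimes>\<^sub>M power_measure X n \<rightarrow>\<^sub>M power_measure X (Suc n)"
  unfolding insert_at_def split_beta
proof (rule measurable_restrict)
  fix i assume i: "i \<in> {..<Suc n}"
  show "(\<lambda>p. ((snd p)(n := fst p)) (Transposition.transpose k n i)) \<in> X \<Otimes>\<^sub>M power_measure X n \<rightarrow>\<^sub>M X"
  \<comment> \<open>Exactly one coordinate reads the new point; every other one reads an index below
    \<open>n\<close>, hence a coordinate of the old sample.\<close>
  proof (cases "Transposition.transpose k n i = n")
    case False
    then have "Transposition.transpose k n i \<in> {..<n}"
      using i assms by (auto simp: Transposition.transpose_def split: if_splits)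
    then have "(\<lambda>p. snd p (Transposition.transpose k n i)) \<in> X \<Otimes>\<^sub>M power_measure X n \<rightarrow>\<^sub>M X"
      by measurable
    with False show ?thesis by simp
  qed simp
qed

text \<open>Appending an independent point yields the power with one more factor, and permuting
  identical factors by the injective transposition preserves it.\<close>

lemma distr_insert_at:
  assumes "prob_space P" "k \<le> n"
  shows "distr (P \<Otimes>\<^sub>M power_measure P n) (power_measure P (Suc n)) (\<lambda>(y, x). insert_at n k y x)
    = power_measure P (Suc n)"
proof -
  have tr: "Transposition.transpose k n \<in> {..<Suc n} \<rightarrow> {..<Suc n}"
    using assms(2) by (auto simp: Transposition.transpose_def)
  let ?u = "\<lambda>(y, x). x(n := y)" and ?r = "\<lambda>w. \<lambda>i\<in>{..<Suc n}. w (Transposition.transpose k n i)"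
  have I: "insert n {..<n} = {..<Suc n}" by auto
  have u: "?u \<in> P \<Otimes>\<^sub>M power_measure P n \<rightarrow>\<^sub>M power_measure P (Suc n)"
    using measurable_add_dim[of n "{..<n}" "\<lambda>_. P"] unfolding I[symmetric]
    by measurable
  have r: "?r \<in> power_measure P (Suc n) \<rightarrow>\<^sub>M power_measure P (Suc n)"
    using tr by (intro measurable_restrict measurable_component_singleton) auto
  have "distr (power_measure P (Suc n)) (power_measure P (Suc n)) ?r = power_measure P (Suc n)"
    using distr_PiM_reindex[of "{..<Suc n}" "\<lambda>_. P" "Transposition.transpose k n" "{..<Suc n}"] tr assms(1)
      inj_on_subset[OF inj_transpose[of k n]]
    by simp
  moreover have "distr (P \<Otimes>\<^sub>M power_measure P n) (power_measure P (Suc n)) ?u = power_measure P (Suc n)"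
    using distr_pair_PiM_eq_PiM[of "{..<n}" "\<lambda>_. P" n] assms(1) by (simp add: I)
  moreover have "?r \<circ> ?u = (\<lambda>(y, x). insert_at n k y x)"
    by (auto simp: fun_eq_iff insert_at_def)
  ultimately show ?thesis
    using distr_distr[OF r u] by metis
qed

text \<open>The change of measure behind the proof: drawing the inserted point from the measure with
  density \<open>g\<close> amounts to weighting an i.i.d. sample of size \<open>n + 1\<close> by
  \<open>g\<close> at position \<open>k\<close>.\<close>

lemma nn_integral_insert_at_density:
  assumes "prob_space P" "k \<le> n" and g[measurable]: "g \<in> borel_measurable P"
    and F[measurable]: "F \<in> borel_measurable (power_measure P (Suc n))"
  shows "(\<integral>\<^sup>+x. (\<integral>\<^sup>+y. F (insert_at n k y x) \<partial>density P g) \<partial>power_measure P n)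
    = (\<integral>\<^sup>+z. g (z k) * F z \<partial>power_measure P (Suc n))"
proof -
  interpret P: prob_space P by fact
  interpret N: prob_space "power_measure P n" by (intro prob_space_PiM assms)
  interpret pair_sigma_finite P "power_measure P n" ..
  note ins[measurable] = measurable_insert_at[OF assms(2), of P]
  have k: "k \<in> {..<Suc n}" using assms(2) by simp
  have [measurable]: "(\<lambda>z. z k) \<in> power_measure P (Suc n) \<rightarrow>\<^sub>M P"
    by (rule measurable_component_singleton[OF k])
  have "(\<integral>\<^sup>+x. (\<integral>\<^sup>+y. F (insert_at n k y x) \<partial>density P g) \<partial>power_measure P n)
      = (\<integral>\<^sup>+x. (\<integral>\<^sup>+y. g y * F (insert_at n k y x) \<partial>P) \<partial>power_measure P n)"
    by (intro nn_integral_cong nn_integral_density)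
       (auto intro!: measurable_compose[OF _ F] measurable_compose[OF _ ins, simplified])
  also have "\<dots> = (\<integral>\<^sup>+p. (case p of (y, x) \<Rightarrow> g y * F (insert_at n k y x)) \<partial>(P \<Otimes>\<^sub>M power_measure P n))"
    by (subst nn_integral_snd[symmetric]) (auto simp: split_beta')
  \<comment> \<open>Since coordinate \<open>k\<close> of the enlarged sample is \<open>y\<close>,
    the weight \<open>g y\<close> factors through the insertion map, so the integral can be pushed
    forward.\<close>
  also have "\<dots> = (\<integral>\<^sup>+p. (\<lambda>z. g (z k) * F z) ((\<lambda>(y, x). insert_at n k y x) p) \<partial>(P \<Otimes>\<^sub>M power_measure P n))"
    using assms(2) by (intro nn_integral_cong) (auto simp: insert_at_nth)
  also have "\<dots> = (\<integral>\<^sup>+z. g (z k) * F z \<partial>power_measure P (Suc n))"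
    by (subst nn_integral_distr[OF ins, symmetric]) (simp_all only: distr_insert_at[OF assms(1,2)], measurable)
  finally show ?thesis .
qed

section \<open>Losses and risks as extended non-negative integrals\<close>

lemma decision_procedure_kernel:
  assumes "\<kappa> \<in> decision_procedures Z A" "x \<in> space Z"
  shows "prob_space (\<kappa> x)" "sets (\<kappa> x) = sets (count_space A)" "space (\<kappa> x) = A"
proof -
  have "\<kappa> x \<in> space (prob_algebra (count_space A))"
    using assms unfolding decision_procedures_def by (blast intro: measurable_space)
  then show k: "prob_space (\<kappa> x)" "sets (\<kappa> x) = sets (count_space A)"
    by (auto simp: space_prob_algebra)
  show "space (\<kappa> x) = A" using sets_eq_imp_space_eq[OF k(2)] by simp
qed

lemma decision_procedure_loss:
  assumes dp: "decision_problem \<Theta> A L" and \<theta>: "\<theta> \<in> \<Theta>"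
    and \<kappa>: "\<kappa> \<in> decision_procedures Z A" and x: "x \<in> space Z"
  shows "(\<integral>\<^sup>+a. ennreal (L a \<theta>) \<partial>\<kappa> x) = ennreal (\<integral>a. L a \<theta> \<partial>\<kappa> x)"
    and "0 \<le> (\<integral>a. L a \<theta> \<partial>\<kappa> x)" "(\<integral>a. L a \<theta> \<partial>\<kappa> x) \<le> 1"
proof -
  note k = decision_procedure_kernel[OF \<kappa> x]
  interpret K: prob_space "\<kappa> x" by (rule k(1))
  have b: "0 \<le> L a \<theta>" "L a \<theta> \<le> 1" if "a \<in> space (\<kappa> x)" for a
    using dp that \<theta> k(3) by (auto simp: decision_problem_def)
  have int: "integrable (\<kappa> x) (\<lambda>a. L a \<theta>)"
    by (rule K.integrable_const_bound[where B=1])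
      (use b in \<open>auto intro!: AE_I2 simp: measurable_cong_sets[OF k(2) refl]\<close>)
  show "(\<integral>\<^sup>+a. ennreal (L a \<theta>) \<partial>\<kappa> x) = ennreal (\<integral>a. L a \<theta> \<partial>\<kappa> x)"
    by (rule nn_integral_eq_integral[OF int]) (use b in auto)
  show "0 \<le> (\<integral>a. L a \<theta> \<partial>\<kappa> x)" by (rule integral_nonneg_AE) (use b in auto)
  show "(\<integral>a. L a \<theta> \<partial>\<kappa> x) \<le> 1" by (rule K.integral_le_const[OF int]) (use b in auto)
qed

lemma measurable_decision_procedure_loss:
  assumes "\<kappa> \<in> decision_procedures Z A"
  shows "(\<lambda>x. \<integral>a. L a \<theta> \<partial>\<kappa> x) \<in> borel_measurable Z"
    and "(\<lambda>x. \<integral>\<^sup>+a. ennreal (L a \<theta>) \<partial>\<kappa> x) \<in> borel_measurable Z"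
proof -
  have [measurable]: "\<kappa> \<in> Z \<rightarrow>\<^sub>M subprob_algebra (count_space A)"
    using assms unfolding decision_procedures_def by (rule measurable_prob_algebraD)
  show "(\<lambda>x. \<integral>a. L a \<theta> \<partial>\<kappa> x) \<in> borel_measurable Z"
    by (rule measurable_compose[OF _ integral_measurable_subprob_algebra]) measurable
  show "(\<lambda>x. \<integral>\<^sup>+a. ennreal (L a \<theta>) \<partial>\<kappa> x) \<in> borel_measurable Z"
    by (rule measurable_compose[OF _ nn_integral_measurable_subprob_algebra]) measurable
qed

text \<open>Losses in \<open>[0,1]\<close> make both Bochner integrals genuine rather than the
  default value 0, so the risk can be computed with Tonelli and without further integrability
  checks.\<close>

lemma ennreal_risk:
  assumes dp: "decision_problem \<Theta> A L" and \<theta>: "\<theta> \<in> \<Theta>"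
    and M: "prob_space (P \<theta>)" "sets (P \<theta>) = sets Z" and \<kappa>: "\<kappa> \<in> decision_procedures Z A"
  shows "ennreal (risk P L \<kappa> \<theta>) = (\<integral>\<^sup>+x. (\<integral>\<^sup>+a. ennreal (L a \<theta>) \<partial>\<kappa> x) \<partial>P \<theta>)"
proof -
  interpret prob_space "P \<theta>" by (rule M(1))
  note sp = sets_eq_imp_space_eq[OF M(2)]
  note loss = decision_procedure_loss[OF dp \<theta> \<kappa>]
  have "integrable (P \<theta>) (\<lambda>x. \<integral>a. L a \<theta> \<partial>\<kappa> x)"
    by (rule integrable_const_bound[where B=1])
      (use loss(2,3) sp measurable_decision_procedure_loss(1)[OF \<kappa>] in
        \<open>auto intro!: AE_I2 simp: measurable_cong_sets[OF M(2) refl]\<close>)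
  then have "ennreal (risk P L \<kappa> \<theta>) = (\<integral>\<^sup>+x. ennreal (\<integral>a. L a \<theta> \<partial>\<kappa> x) \<partial>P \<theta>)"
    unfolding risk_def
    by (intro nn_integral_eq_integral[symmetric]) (use loss(2) sp in auto)
  also have "\<dots> = (\<integral>\<^sup>+x. (\<integral>\<^sup>+a. ennreal (L a \<theta>) \<partial>\<kappa> x) \<partial>P \<theta>)"
    by (intro nn_integral_cong) (use loss(1) sp in auto)
  finally show ?thesis .
qed

section \<open>The randomised insertion procedure\<close>

text \<open>The position \<open>k\<close> is uniform on the \<open>n + 1\<close> possible ones and
  independent of the point \<open>y\<close>. The law of \<open>(k, y)\<close> does not involve the
  parameter, so one procedure serves every \<theta>.\<close>

definition random_insertion ::
  "nat \<Rightarrow> 'x measure \<Rightarrow> ((nat \<Rightarrow> 'x) \<Rightarrow> nat measure) \<Rightarrow> (nat \<Rightarrow> 'x) \<Rightarrow> nat measure" where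
  "random_insertion n Q \<rho> x =
     (uniform_count_measure {..n} \<Otimes>\<^sub>M Q) \<bind> (\<lambda>(k, y). \<rho> (insert_at n k y x))"

text \<open>The position lives in a countable discrete space, so joint measurability follows from
  measurability of the insertion map at each fixed \<open>k\<close>.\<close>

lemma measurable_insertion_kernel:
  assumes "\<rho> \<in> decision_procedures (power_measure X (Suc n)) A"
  shows "(\<lambda>(x, k, y). \<rho> (insert_at n k y x)) \<in>
    power_measure X n \<Otimes>\<^sub>M (count_space {..n} \<Otimes>\<^sub>M X) \<rightarrow>\<^sub>M prob_algebra (count_space A)"
proof -
  have \<rho>': "\<rho> \<in> power_measure X (Suc n) \<rightarrow>\<^sub>M prob_algebra (count_space A)"
    using assms by (simp add: decision_procedures_def)
  have ins: "(\<lambda>q. insert_at n (fst q) (fst (snd q)) (snd (snd q))) \<in>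
     count_space {..n} \<Otimes>\<^sub>M (X \<Otimes>\<^sub>M power_measure X n) \<rightarrow>\<^sub>M power_measure X (Suc n)"
    using measurable_insert_at[of _ n X]
    by (intro measurable_pair_measure_countable1) (auto simp: split_beta')
  \<comment> \<open>The countable factor stands first in \<open>ins\<close>; this map restores the
    order in which the sample precedes the randomisation.\<close>
  have rotate: "(\<lambda>p. (fst (snd p), snd (snd p), fst p)) \<in>
     power_measure X n \<Otimes>\<^sub>M (count_space {..n} \<Otimes>\<^sub>M X) \<rightarrow>\<^sub>M
     count_space {..n} \<Otimes>\<^sub>M (X \<Otimes>\<^sub>M power_measure X n)"
    by measurable
  show ?thesis
    using measurable_compose[OF measurable_compose[OF rotate ins] \<rho>'] by (simp add: split_beta')
qed

text \<open>Mixing a jointly measurable Markov kernel over a fixed probability law leaves a Markov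
  kernel in the remaining variable.\<close>

lemma random_insertion_decision_procedure:
  assumes Q: "prob_space Q" "sets Q = sets X"
    and \<rho>: "\<rho> \<in> decision_procedures (power_measure X (Suc n)) A"
  shows "random_insertion n Q \<rho> \<in> decision_procedures (power_measure X n) A"
proof -
  interpret Q: prob_space Q by fact
  interpret U: prob_space "uniform_count_measure {..n}"
    by (rule prob_space_uniform_count_measure) auto
  interpret UQ: pair_prob_space "uniform_count_measure {..n}" Q ..
  have "sets (uniform_count_measure {..n} \<Otimes>\<^sub>M Q) = sets (count_space {..n} \<Otimes>\<^sub>M X)"
    using Q(2) by (intro sets_pair_measure_cong) (simp_all add: sets_uniform_count_measure)
  then have "uniform_count_measure {..n} \<Otimes>\<^sub>M Q \<in> space (prob_algebra (count_space {..n} \<Otimes>\<^sub>M X))"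
    by (simp add: space_prob_algebra UQ.prob_space_axioms)
  then show ?thesis
    unfolding decision_procedures_def random_insertion_def
    by (intro measurable_bind_prob_space2[where N="count_space {..n} \<Otimes>\<^sub>M X"] measurable_const)
       (use measurable_insertion_kernel[OF \<rho>] in \<open>simp_all add: split_beta'\<close>)
qed

lemma nn_integral_random_insertion:
  assumes Q: "prob_space Q" "sets Q = sets X"
    and \<rho>: "\<rho> \<in> decision_procedures (power_measure X (Suc n)) A"
    and x: "x \<in> space (power_measure X n)" and f: "f \<in> borel_measurable (count_space A)"
  shows "(\<integral>\<^sup>+a. f a \<partial>random_insertion n Q \<rho> x)
    = (\<Sum>k\<le>n. \<integral>\<^sup>+y. (\<integral>\<^sup>+a. f a \<partial>\<rho> (insert_at n k y x)) \<partial>Q) / of_nat (Suc n)"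
proof -
  interpret Q: prob_space Q by fact
  have sU: "sets (uniform_count_measure {..n} \<Otimes>\<^sub>M Q) = sets (count_space {..n} \<Otimes>\<^sub>M X)"
    using Q(2) by (intro sets_pair_measure_cong) (simp_all add: sets_uniform_count_measure)
  have ker: "(\<lambda>p. case p of (k, y) \<Rightarrow> \<rho> (insert_at n k y x)) \<in>
      uniform_count_measure {..n} \<Otimes>\<^sub>M Q \<rightarrow>\<^sub>M subprob_algebra (count_space A)"
    using measurable_prob_algebraD[OF measurable_Pair2[OF measurable_insertion_kernel[OF \<rho>] x]]
    by (simp add: split_beta' measurable_cong_sets[OF sU refl])
  have "(\<integral>\<^sup>+a. f a \<partial>random_insertion n Q \<rho> x) =
      (\<integral>\<^sup>+p. (\<integral>\<^sup>+a. f a \<partial>(case p of (k, y) \<Rightarrow> \<rho> (insert_at n k y x)))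
         \<partial>(uniform_count_measure {..n} \<Otimes>\<^sub>M Q))"
    unfolding random_insertion_def by (rule nn_integral_bind[OF f ker])
  also have "\<dots> = (\<integral>\<^sup>+k. (\<integral>\<^sup>+y. (\<integral>\<^sup>+a. f a \<partial>\<rho> (insert_at n k y x)) \<partial>Q) \<partial>uniform_count_measure {..n})"
    using measurable_compose[OF ker nn_integral_measurable_subprob_algebra[OF f]]
    by (subst Q.nn_integral_fst[symmetric]) auto
  \<comment> \<open>The uniform law puts mass \<open>1 / Suc n\<close> on each of the
    \<open>Suc n\<close> points of \<open>{..n}\<close>, so the outer integral is a finite
    average.\<close>
  also have "\<dots> = (\<Sum>k\<le>n. \<integral>\<^sup>+y. (\<integral>\<^sup>+a. f a \<partial>\<rho> (insert_at n k y x)) \<partial>Q) / of_nat (Suc n)"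
    unfolding uniform_count_measure_def
    by (subst nn_integral_point_measure_finite)
      (auto simp: sum_distrib_left divide_ennreal_def ennreal_of_nat_eq_real_of_nat
        inverse_ennreal inverse_eq_divide mult.commute simp del: of_nat_Suc)
  finally show ?thesis .
qed

section \<open>Mean deviation of the averaged density\<close>

lemma measurable_power_measure_component:
  "i < n \<Longrightarrow> g \<in> M \<rightarrow>\<^sub>M N \<Longrightarrow> (\<lambda>z. g (z i)) \<in> power_measure M n \<rightarrow>\<^sub>M N"
  by (rule measurable_compose[OF measurable_component_singleton]) auto

text \<open>The deviation of the average has a sub-Gaussian tail with rate
  \<open>s * real m\<close>; integrating it produces the factor
  \<open>1 / sqrt (real m)\<close>.\<close>

lemma indistinguishable_mean_deviation:
  assumes P: "prob_space P" and C: "C \<ge> 1" and s: "s > 0" and m: "m \<ge> 1"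
    and g: "g \<in> borel_measurable P"
    and tail: "\<And>t. t \<ge> 0 \<Longrightarrow> measure (PiM UNIV (\<lambda>_::nat. P))
             {\<xi> \<in> space (PiM UNIV (\<lambda>_::nat. P)). \<bar>(\<Sum>i<m. g (\<xi> i)) - real m\<bar> > real m * t}
           \<le> C * exp (- (s * real m * t\<^sup>2))"
  shows "(\<integral>\<^sup>+z. ennreal \<bar>(\<Sum>i<m. g (z i)) / real m - 1\<bar> \<partial>power_measure P m)
    \<le> ennreal (C * sqrt (pi / (4 * s)) * (1 / sqrt (real m)))"
proof -
  let ?S = "PiM UNIV (\<lambda>_::nat. P)"
  let ?h = "\<lambda>z. \<bar>(\<Sum>i<m. g (z i)) / real m - 1\<bar>"
  note g[measurable]
  interpret product_prob_space "\<lambda>_::nat. P" UNIV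
    using P by (intro product_prob_spaceI) auto
  have hS: "?h \<in> borel_measurable ?S" by measurable
  have "(\<lambda>z. g (z i)) \<in> borel_measurable (power_measure P m)" if "i < m" for i
    using that g by (rule measurable_power_measure_component)
  then have hm: "?h \<in> borel_measurable (power_measure P m)"
    by (intro borel_measurable_abs borel_measurable_diff borel_measurable_divide borel_measurable_sum) auto
  \<comment> \<open>The tail bound lives on the infinite product; as \<open>?h\<close> reads only
    the first \<open>m\<close> coordinates, its integral is the same there.\<close>
  have "(\<integral>\<^sup>+z. ennreal (?h z) \<partial>power_measure P m)
      = (\<integral>\<^sup>+z. ennreal (?h z) \<partial>distr ?S (power_measure P m) (\<lambda>x. restrict x {..<m}))"
    by (subst distr_PiM_restrict_finite) auto
  also have "\<dots> = (\<integral>\<^sup>+z. ennreal (?h z) \<partial>?S)"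
    using hm by (subst nn_integral_distr) (auto intro: measurable_restrict_subset)
  also have "\<dots> \<le> ennreal (C * sqrt (pi / (4 * (s * real m))))"
  proof (rule nn_integral_subgaussian_tail)
    show "measure ?S {z \<in> space ?S. t < ?h z} \<le> C * exp (- (s * real m * t\<^sup>2))" if "t \<ge> 0" for t
    proof -
      \<comment> \<open>Multiplying by \<open>real m > 0\<close> turns the deviation of the average
        from 1 into that of the sum from \<open>m\<close>.\<close>
      have "t < ?h z \<longleftrightarrow> real m * t < \<bar>(\<Sum>i<m. g (z i)) - real m\<bar>" for z
      proof -
        have "real m * ?h z = \<bar>real m * ((\<Sum>i<m. g (z i)) / real m - 1)\<bar>"
          by (simp add: abs_mult)
        also have "real m * ((\<Sum>i<m. g (z i)) / real m - 1) = (\<Sum>i<m. g (z i)) - real m"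
          using m by (simp add: field_simps)
        finally show ?thesis using m by (metis mult_less_cancel_left_pos of_nat_0_less_iff less_le_trans zero_less_one)
      qed
      then show ?thesis using tail[OF that] by simp
    qed
  qed (use hS C s m prob_space_axioms in auto)
  also have "C * sqrt (pi / (4 * (s * real m))) = C * sqrt (pi / (4 * s)) * (1 / sqrt (real m))"
    by (simp add: real_sqrt_divide real_sqrt_mult)
  finally show ?thesis .
qed

section \<open>Comparison of risks and the deficiency bound\<close>

text \<open>To be applied pointwise with \<open>u\<close> the averaged density and \<open>v\<close>
  the expected loss at a sample: reweighting a loss in \<open>[0,1]\<close> costs at most the
  distance of the weight from 1.\<close>

lemma mult_le_add_abs_diff:
  fixes u :: real
  assumes "0 \<le> u" "0 \<le> v" "v \<le> 1"
  shows "u * v \<le> v + \<bar>u - 1\<bar>"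
proof -
  have "u * v - v = (u - 1) * v" by (simp add: algebra_simps)
  also have "\<dots> \<le> \<bar>u - 1\<bar> * v" using assms by (intro mult_right_mono) auto
  also have "\<dots> \<le> \<bar>u - 1\<bar>" using assms by (simp add: mult_left_le)
  finally show ?thesis by simp
qed

text \<open>The risk of the insertion procedure is the integral of the loss of \<open>\<rho>\<close>
  against the averaged density, so its excess is at most the mean deviation of that average from
  1.\<close>

lemma risk_random_insertion:
  fixes P :: "'t \<Rightarrow> 'x measure"
  assumes \<theta>: "\<theta> \<in> \<Theta>" and P: "prob_space (P \<theta>)" "sets (P \<theta>) = sets X"
    and C: "C \<ge> 1" and s: "s > 0" and Q: "prob_space Q" "sets Q = sets X"
    and ind: "indistinguishable C s Q (P \<theta>)" and dp: "decision_problem \<Theta> A L"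
    and \<rho>: "\<rho> \<in> decision_procedures (power_measure X (Suc n)) A"
  shows "risk (\<lambda>\<theta>. power_measure (P \<theta>) n) L (random_insertion n Q \<rho>) \<theta>
    \<le> risk (\<lambda>\<theta>. power_measure (P \<theta>) (Suc n)) L \<rho> \<theta>
      + C * sqrt (pi / (4 * s)) * (1 / sqrt (real (Suc n)))"
    (is "?R' \<le> ?R + ?\<epsilon>")
proof -
  let ?M = "\<lambda>n. power_measure (P \<theta>) n"
  \<comment> \<open>Two forms of the same expected loss: \<open>?F\<close> for integration in
    \<open>ennreal\<close>, \<open>?f\<close> for real arithmetic.\<close>
  let ?F = "\<lambda>z. \<integral>\<^sup>+a. ennreal (L a \<theta>) \<partial>\<rho> z" and ?f = "\<lambda>z. \<integral>a. L a \<theta> \<partial>\<rho> z"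
  obtain g :: "'x \<Rightarrow> real" where g[measurable]: "g \<in> borel_measurable (P \<theta>)"
    and gnn: "\<And>x. x \<in> space (P \<theta>) \<Longrightarrow> 0 \<le> g x"
    and Qg: "Q = density (P \<theta>) (\<lambda>x. ennreal (g x))"
    and tail: "\<And>n t. n \<ge> 1 \<Longrightarrow> t \<ge> 0 \<Longrightarrow> measure (PiM UNIV (\<lambda>_::nat. P \<theta>))
       {\<xi> \<in> space (PiM UNIV (\<lambda>_::nat. P \<theta>)). \<bar>(\<Sum>i<n. g (\<xi> i)) - real n\<bar> > real n * t}
           \<le> C * exp (- (s * real n * t\<^sup>2))"
    using ind unfolding indistinguishable_def by blast
  \<comment> \<open>Indexed by \<open>{..<Suc n}\<close> to fit the tail bound; the insertion
    positions \<open>{..n}\<close> form the same set.\<close>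
  let ?avg = "\<lambda>z. (\<Sum>k<Suc n. g (z k)) / real (Suc n)"
  have prob: "prob_space (?M m)" for m using P(1) by (intro prob_space_PiM)
  have sets: "sets (?M m) = sets (power_measure X m)" for m
    using P(2) by (intro sets_PiM_cong) auto
  note sp = sets_eq_imp_space_eq[OF sets]
  have F[measurable]: "?F \<in> borel_measurable (?M (Suc n))"
    using measurable_decision_procedure_loss(2)[OF \<rho>] by (simp add: measurable_cong_sets[OF sets refl])
  have comp[measurable]: "(\<lambda>z. g (z k)) \<in> borel_measurable (?M (Suc n))" if "k < Suc n" for k
    using that g by (rule measurable_power_measure_component)
  have gsum: "?avg \<in> borel_measurable (?M (Suc n))"
    by (intro borel_measurable_divide borel_measurable_sum) (auto intro: comp)
  have gF: "(\<lambda>z. ennreal (g (z k)) * ?F z) \<in> borel_measurable (?M (Suc n))" if "k \<in> {..n}" for k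
    using comp[of k] that by (intro borel_measurable_times_ennreal F) (auto simp: less_Suc_eq_le)
  have Fins: "(\<lambda>x. \<integral>\<^sup>+y. ?F (insert_at n k y x) \<partial>Q) \<in> borel_measurable (?M n)" if "k \<in> {..n}" for k
  proof -
    interpret Q: prob_space Q by fact
    have s: "sets (Q \<Otimes>\<^sub>M ?M n) = sets (P \<theta> \<Otimes>\<^sub>M ?M n)"
      using P(2) Q(2) by (intro sets_pair_measure_cong) simp_all
    have "(\<lambda>(y, x). insert_at n k y x) \<in> Q \<Otimes>\<^sub>M ?M n \<rightarrow>\<^sub>M ?M (Suc n)"
      using measurable_insert_at[of k n "P \<theta>"] that by (simp add: measurable_cong_sets[OF s refl])
    from measurable_compose[OF measurable_compose[OF measurable_pair_swap' this] F]
    show ?thesis by (intro Q.borel_measurable_nn_integral) (simp add: split_beta')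
  qed
  have "ennreal ?R' = (\<integral>\<^sup>+x. (\<integral>\<^sup>+a. ennreal (L a \<theta>) \<partial>random_insertion n Q \<rho> x) \<partial>?M n)"
    by (rule ennreal_risk[where P="\<lambda>\<theta>. power_measure (P \<theta>) n",
          OF dp \<theta> prob sets random_insertion_decision_procedure[OF Q \<rho>]])
  also have "\<dots> = (\<integral>\<^sup>+x. (\<Sum>k\<le>n. \<integral>\<^sup>+y. ?F (insert_at n k y x) \<partial>Q) / of_nat (Suc n) \<partial>?M n)"
    by (intro nn_integral_cong nn_integral_random_insertion[OF Q \<rho>]) (simp_all add: sp)
  also have "\<dots> = (\<Sum>k\<le>n. \<integral>\<^sup>+x. (\<integral>\<^sup>+y. ?F (insert_at n k y x) \<partial>Q) \<partial>?M n) / of_nat (Suc n)"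
    by (simp only: nn_integral_divide[OF borel_measurable_sum[OF Fins]] nn_integral_sum[OF Fins])
  \<comment> \<open>Here \<open>Q\<close> disappears: each insertion position becomes a weight
    \<open>g (z k)\<close> on the sample of size \<open>n + 1\<close>.\<close>
  also have "\<dots> = (\<Sum>k\<le>n. \<integral>\<^sup>+z. ennreal (g (z k)) * ?F z \<partial>?M (Suc n)) / of_nat (Suc n)"
    unfolding Qg using nn_integral_insert_at_density[OF P(1) _ _ F, of _ "\<lambda>x. ennreal (g x)"]
    by simp
  also have "\<dots> = (\<integral>\<^sup>+z. (\<Sum>k\<le>n. ennreal (g (z k)) * ?F z) / of_nat (Suc n) \<partial>?M (Suc n))"
    by (simp only: nn_integral_divide[OF borel_measurable_sum[OF gF]] nn_integral_sum[OF gF])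
  also have "\<dots> \<le> (\<integral>\<^sup>+z. ?F z + ennreal \<bar>?avg z - 1\<bar> \<partial>?M (Suc n))"
  proof (rule nn_integral_mono)
    fix z assume z: "z \<in> space (?M (Suc n))"
    \<comment> \<open>\<open>g\<close> is known to be non-negative only on
      \<open>space (P \<theta>)\<close>, which contains every coordinate of
      \<open>z\<close>.\<close>
    have gz: "0 \<le> g (z k)" if "k \<le> n" for k
      using z that by (intro gnn) (auto simp: space_PiM PiE_iff)
    note loss = decision_procedure_loss[OF dp \<theta> \<rho>, of z, folded sp, OF z]
    have gg: "0 \<le> ?avg z" by (intro divide_nonneg_nonneg sum_nonneg) (auto intro: gz)
    have "(\<Sum>k\<le>n. ennreal (g (z k)) * ?F z) / of_nat (Suc n)
        = ennreal (\<Sum>k\<le>n. g (z k)) * ennreal (?f z) / ennreal (real (Suc n))"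
      unfolding loss(1) sum_distrib_right[symmetric] ennreal_of_nat_eq_real_of_nat
      by (subst sum_ennreal) (auto intro: gz)
    also have "\<dots> = ennreal (?avg z * ?f z)"
      using loss(2) sum_nonneg[of "{..n}" "\<lambda>k. g (z k)"] gz
      by (simp add: ennreal_mult[symmetric] divide_ennreal lessThan_Suc_atMost del: of_nat_Suc)
    also have "\<dots> \<le> ennreal (?f z + \<bar>?avg z - 1\<bar>)"
      by (intro ennreal_leI mult_le_add_abs_diff gg loss(2,3))
    also have "\<dots> = ?F z + ennreal \<bar>?avg z - 1\<bar>"
      using loss by (simp add: ennreal_plus del: of_nat_Suc)
    finally show "(\<Sum>k\<le>n. ennreal (g (z k)) * ?F z) / of_nat (Suc n) \<le> ?F z + ennreal \<bar>?avg z - 1\<bar>" .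
  qed
  also have "\<dots> = (\<integral>\<^sup>+z. ?F z \<partial>?M (Suc n)) + (\<integral>\<^sup>+z. ennreal \<bar>?avg z - 1\<bar> \<partial>?M (Suc n))"
    using gsum by (intro nn_integral_add) auto
  also have "(\<integral>\<^sup>+z. ?F z \<partial>?M (Suc n)) = ennreal ?R"
    by (rule ennreal_risk[where P="\<lambda>\<theta>. power_measure (P \<theta>) (Suc n)", OF dp \<theta> prob sets \<rho>, symmetric])
  \<comment> \<open>The average has \<open>Suc n\<close> terms, so the deviation bound is taken at
    \<open>m = Suc n\<close>; this gives \<open>sqrt (n + 1)\<close> in the rate.\<close>
  also have "ennreal ?R + (\<integral>\<^sup>+z. ennreal \<bar>?avg z - 1\<bar> \<partial>?M (Suc n)) \<le> ennreal ?R + ennreal ?\<epsilon>"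
    by (intro add_left_mono indistinguishable_mean_deviation[OF P(1) C s _ g tail]) auto
  also have "\<dots> = ennreal (?R + ?\<epsilon>)"
    using risk_bounds[where P="\<lambda>\<theta>. power_measure (P \<theta>) (Suc n)", OF dp \<theta> prob sets \<rho>] C s by (intro ennreal_plus[symmetric]) auto
  finally show ?thesis
    \<comment> \<open>Returning to the reals requires the right-hand side to be
      non-negative.\<close>
    using risk_bounds[where P="\<lambda>\<theta>. power_measure (P \<theta>) (Suc n)", OF dp \<theta> prob sets \<rho>] C s by (subst (asm) ennreal_le_iff) auto
qed

theorem theorem1:
  fixes \<Theta> :: "'t set" and X :: "'x measure" and P :: "'t \<Rightarrow> 'x measure"
    and C s :: real and Q :: "'x measure" and n :: nat
  assumes "statistical_experiment \<Theta> X P"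
    and "C \<ge> 1" and "s > 0"
    and "prob_space Q" and "sets Q = sets X"
    and "\<And>\<theta>. \<theta> \<in> \<Theta> \<Longrightarrow> indistinguishable C s Q (P \<theta>)"
    and "n \<ge> 1"
  shows "deficiency \<Theta>
           (power_measure X n) (\<lambda>\<theta>. power_measure (P \<theta>) n)
           (power_measure X (n + 1)) (\<lambda>\<theta>. power_measure (P \<theta>) (n + 1))
         \<le> C * sqrt (pi / (4 * s)) * (1 / sqrt (real (n + 1)))"
proof -
  let ?\<epsilon> = "C * sqrt (pi / (4 * s)) * (1 / sqrt (real (Suc n)))"
  have P: "prob_space (P \<theta>)" "sets (P \<theta>) = sets X" if "\<theta> \<in> \<Theta>" for \<theta>
    using assms(1) that by (auto simp: statistical_experiment_def)
  have "deficient_by \<Theta> (power_measure X n) (\<lambda>\<theta>. power_measure (P \<theta>) n)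
      (power_measure X (Suc n)) (\<lambda>\<theta>. power_measure (P \<theta>) (Suc n)) ?\<epsilon>"
    unfolding deficient_by_def
  proof (intro allI impI ballI)
    fix A L \<rho>
    assume dp: "decision_problem \<Theta> A L"
      and \<rho>: "\<rho> \<in> decision_procedures (power_measure X (Suc n)) A"
    show "\<exists>\<rho>'\<in>decision_procedures (power_measure X n) A. \<forall>\<theta>\<in>\<Theta>.
        risk (\<lambda>\<theta>. power_measure (P \<theta>) n) L \<rho>' \<theta>
        \<le> risk (\<lambda>\<theta>. power_measure (P \<theta>) (Suc n)) L \<rho> \<theta> + ?\<epsilon>"
      \<comment> \<open>The witness is \<open>random_insertion n Q \<rho>\<close>, chosen before
        \<theta>; this is where a common \<open>Q\<close> for all parameters enters.\<close>
      using random_insertion_decision_procedure[OF assms(4,5) \<rho>]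
        risk_random_insertion[where P=P, OF _ _ _ assms(2-6) dp \<rho>] P by blast
  qed
  moreover have "0 \<le> ?\<epsilon>" using assms(2,3) by simp
  ultimately show ?thesis
    unfolding deficiency_def Suc_eq_plus1[symmetric]
    \<comment> \<open>On the reals an infimum lies below each member only for sets bounded below;
      here 0 is a lower bound.\<close>
    by (intro cInf_lower bdd_belowI[where m=0]) auto
qed

end
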